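(* Let $d \ge 1$ be an integer and let $f, f'$ be binary strings with $|f| \le d$ and $|f'| \le d$. If $Q_d(f) \cong Q_d(f')$, then $|f| = |f'|$.
   Context: A binary string of length $n$ (with $n\ge 1$) is an element of $\{0,1\}^n$; the length of a string $f$ is denoted $|f|$. The $d$-cube $Q_d$ is the graph whose vertices are the binary strings of length $d$, with two vertices adjacent if and only if the strings differ in exactly one position. For a binary string $f$, the generalized Fibonacci cube $Q_d(f)$ is the subgraph of $Q_d$ induced by the set of all strings of length $d$ that do not contain $f$ as a consecutive (contiguous) substring. $G \cong H$ means that the graphs $G$ and $H$ are isomorphic. *)

theory Defs
  imports "Graph_Theory.Graph_Theory" "HOL-Library.Sublist"
begin

type_synonym bitstring = "bool list"

definition binary_strings :: "nat \<Rightarrow> bitstring set" where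
  "binary_strings n = {u. length u = n}"

(* Undirected simple graphs follow the convention of Graph_Theory: symmetric digraphs in
   which an edge uv is represented by the two arcs (u, v) and (v, u). *)

definition hypercube :: "nat \<Rightarrow> bitstring pair_pre_digraph" where
  "hypercube d = \<lparr> pverts = binary_strings d,
     parcs = {(u, v). u \<in> binary_strings d \<and> v \<in> binary_strings d \<and>
                      (\<exists>!i. i < d \<and> u ! i \<noteq> v ! i)} \<rparr>"

definition fib_cube :: "nat \<Rightarrow> bitstring \<Rightarrow> (bitstring, bitstring \<times> bitstring) pre_digraph" where
  "fib_cube d f = with_proj (hypercube d) \<restriction> {u \<in> binary_strings d. \<not> sublist f u}"

lemma finite_binary_strings: "finite (binary_strings n)"
  using finite_lists_length_eq[of "UNIV :: bool set" n] by (simp add: binary_strings_def)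

lemma pair_graph_hypercube: "pair_graph (hypercube d)"
proof
  have "parcs (hypercube d) \<subseteq> binary_strings d \<times> binary_strings d"
    by (auto simp: hypercube_def)
  then show "finite (parcs (hypercube d))"
    using finite_subset finite_binary_strings by blast
  show "finite (pverts (hypercube d))"
    by (simp add: hypercube_def finite_binary_strings)
  show "symmetric (with_proj (hypercube d))"
    unfolding symmetric_def sym_def by (auto simp: hypercube_def)
qed (auto simp: hypercube_def)

lemma verts_fib_cube: "verts (fib_cube d f) = {u. length u = d \<and> \<not> sublist f u}"
  by (auto simp: fib_cube_def binary_strings_def)

lemma dominates_fib_cube_iff:
  "u \<rightarrow>\<^bsub>fib_cube d f\<^esub> v \<longleftrightarrow>
     u \<in> verts (fib_cube d f) \<and> v \<in> verts (fib_cube d f) \<and> (\<exists>!i. i < d \<and> u ! i \<noteq> v ! i)"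
  unfolding arcs_ends_conv verts_fib_cube
  by (auto simp: fib_cube_def hypercube_def binary_strings_def image_iff)

lemma graph_fib_cube: "graph (fib_cube d f)"
proof -
  interpret H: pair_graph "hypercube d" by (rule pair_graph_hypercube)
  show ?thesis
  proof
    show "finite (verts (fib_cube d f))"
      by (simp add: fib_cube_def finite_binary_strings)
    show "finite (arcs (fib_cube d f))"
      using H.pair_finite_arcs by (simp add: fib_cube_def)
    show "symmetric (fib_cube d f)"
      using H.sym_arcs unfolding symmetric_conv by (fastforce simp: fib_cube_def)
  qed (auto simp: fib_cube_def arc_to_ends_def dest: H.pair_no_loops)
qed

lemma arcs_fib_cube:
  "arcs (fib_cube d f) = arcs_ends (fib_cube d f)"
  by (auto simp: arcs_ends_conv fib_cube_def)

(* Isomorphism of these symmetric digraphs is isomorphism of undirected simple graphs. *)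
lemma digraph_iso_fib_cube_iff:
  "digraph_iso (fib_cube d f) (fib_cube e g) \<longleftrightarrow>
     (\<exists>h. bij_betw h (verts (fib_cube d f)) (verts (fib_cube e g)) \<and>
          (\<forall>u \<in> verts (fib_cube d f). \<forall>v \<in> verts (fib_cube d f).
             u \<rightarrow>\<^bsub>fib_cube d f\<^esub> v \<longleftrightarrow> h u \<rightarrow>\<^bsub>fib_cube e g\<^esub> h v))"
  (is "digraph_iso ?G ?H \<longleftrightarrow> ?R")
proof -
  interpret G: graph ?G by (rule graph_fib_cube)
  interpret H: graph ?H by (rule graph_fib_cube)
  have th: "tail ?G = fst" "head ?G = snd" "tail ?H = fst" "head ?H = snd"
    by (simp_all add: fib_cube_def)
  show ?thesis
  proof
    assume "digraph_iso ?G ?H"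
    then obtain k where k: "G.digraph_isomorphism k" and H: "?H = app_iso k ?G"
      by (auto simp: digraph_iso_def)
    let ?h = "iso_verts k"
    have vH: "verts ?H = ?h ` verts ?G" and aH: "arcs ?H = iso_arcs k ` arcs ?G"
      and tH: "iso_tail k = fst" "iso_head k = snd"
      using arg_cong[OF H, of verts] arg_cong[OF H, of arcs]
        arg_cong[OF H, of tail] arg_cong[OF H, of head] th by simp_all
    have inj: "inj_on ?h (verts ?G)" using k by (simp add: G.digraph_isomorphism_def)
    have ka: "iso_arcs k a = (?h (fst a), ?h (snd a))" if "a \<in> arcs ?G" for a
      using k that th tH by (simp add: G.digraph_isomorphism_def prod_eq_iff)
    have "u \<rightarrow>\<^bsub>?G\<^esub> v \<longleftrightarrow> ?h u \<rightarrow>\<^bsub>?H\<^esub> ?h v"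
      if "u \<in> verts ?G" "v \<in> verts ?G" for u v
    proof
      assume "u \<rightarrow>\<^bsub>?G\<^esub> v"
      then show "?h u \<rightarrow>\<^bsub>?H\<^esub> ?h v"
        using ka[of "(u, v)"] aH by (force simp: arcs_fib_cube[symmetric])
    next
      assume "?h u \<rightarrow>\<^bsub>?H\<^esub> ?h v"
      then obtain a where a: "a \<in> arcs ?G" "(?h u, ?h v) = iso_arcs k a"
        using aH by (auto simp: arcs_fib_cube[symmetric])
      then have "?h u = ?h (fst a)" "?h v = ?h (snd a)" using ka by auto
      then have "u = fst a" "v = snd a"
        using inj that a(1) G.tail_in_verts[of a] G.head_in_verts[of a] th
        by (auto dest: inj_onD)
      then show "u \<rightarrow>\<^bsub>?G\<^esub> v" using a(1) by (simp add: arcs_fib_cube[symmetric])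
    qed
    then show ?R using inj vH by (intro exI[of _ ?h]) (auto simp: bij_betw_def)
  next
    assume ?R
    then obtain h where bij: "bij_betw h (verts ?G) (verts ?H)"
      and h: "\<And>u v. \<lbrakk>u \<in> verts ?G; v \<in> verts ?G\<rbrakk> \<Longrightarrow> u \<rightarrow>\<^bsub>?G\<^esub> v \<longleftrightarrow> h u \<rightarrow>\<^bsub>?H\<^esub> h v"
      by blast
    let ?k = "\<lparr> iso_verts = h, iso_arcs = map_prod h h, iso_head = snd, iso_tail = fst \<rparr>"
    have inj: "inj_on h (verts ?G)" and im: "h ` verts ?G = verts ?H"
      using bij by (auto simp: bij_betw_def)
    have sub: "arcs ?G \<subseteq> verts ?G \<times> verts ?G"
      using G.tail_in_verts G.head_in_verts th by (force simp: mem_Times_iff)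
    have "inj_on (map_prod h h) (arcs ?G)"
      by (rule inj_on_subset[OF map_prod_inj_on[OF inj inj] sub])
    then have "G.digraph_isomorphism ?k"
      using inj th G.wf_digraph by (auto simp: G.digraph_isomorphism_def)
    moreover have "arcs ?H = map_prod h h ` arcs ?G"
    proof (intro equalityI subsetI)
      fix b assume b: "b \<in> arcs ?H"
      then have "fst b \<in> verts ?H" "snd b \<in> verts ?H"
        using H.tail_in_verts[OF b] H.head_in_verts[OF b] th by simp_all
      then obtain u v where "u \<in> verts ?G" "v \<in> verts ?G" "fst b = h u" "snd b = h v"
        unfolding im[symmetric] by blast
      then have uv: "u \<in> verts ?G" "v \<in> verts ?G" "b = (h u, h v)"
        by (simp_all add: prod_eq_iff)
      then have "(u, v) \<in> arcs ?G" using h[of u v] b by (simp add: arcs_fib_cube)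
      then show "b \<in> map_prod h h ` arcs ?G" using uv(3) by force
    next
      fix b assume "b \<in> map_prod h h ` arcs ?G"
      then obtain u v where "(u, v) \<in> arcs ?G" "b = (h u, h v)" by auto
      then show "b \<in> arcs ?H" using h[of u v] sub by (auto simp: arcs_fib_cube)
    qed
    ultimately have "G.digraph_isomorphism ?k \<and> ?H = app_iso ?k ?G"
      using im th by (auto simp: app_iso_def intro!: pre_digraph.equality)
    then show "digraph_iso ?G ?H" unfolding digraph_iso_def by blast
  qed
qed

end

theory Submission
  imports Defs
begin

text \<open>
  Already the number of vertices of \<open>Q\<^sub>d(f)\<close> reveals the length of \<open>f\<close> when \<open>\<bar>f\<bar> \<le> d\<close>: a longer
  forbidden word leaves strictly more strings.  Write \<open>a\<^sub>d\<close> for the number of strings of length \<open>d\<close>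
  that avoid a word \<open>f\<close> of length \<open>n\<close>, and \<open>b\<^sub>d\<close> for the number of those that avoid a word \<open>g\<close> of
  length \<open>n + 1\<close>.  How fast these sequences grow depends on the self-overlaps of the words, but
  \<open>n\<close>-step Fibonacci sequences separate the two lengths whatever the overlaps are:
  \<open>a\<^sub>d \<le> a\<^sub>d\<^sub>-\<^sub>1 + \<dots> + a\<^sub>d\<^sub>-\<^sub>n\<close> and \<open>b\<^sub>d \<ge> 1 + b\<^sub>d\<^sub>-\<^sub>1 + \<dots> + b\<^sub>d\<^sub>-\<^sub>n\<close> for \<open>d \<ge> n\<close>.

  The first bound (\<open>card_avoiding_le_sum\<close>) holds because the last \<open>n\<close> letters of a string avoiding
  \<open>f\<close> differ from \<open>f\<close>, and the string is determined by its part before the last disagreement.  The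
  second (\<open>card_avoiding_ge_sum\<close>) telescopes the inequality \<open>2 b\<^sub>d \<le> b\<^sub>d\<^sub>+\<^sub>1 + b\<^sub>d\<^sub>-\<^sub>n\<close>
  (\<open>double_card_avoiding_le\<close>): a one-letter extension of a string avoiding \<open>g\<close> either avoids \<open>g\<close> or
  ends in its first occurrence of \<open>g\<close>.  As \<open>a\<^sub>d = b\<^sub>d = 2\<^sup>d\<close> for \<open>d < n\<close>, induction on \<open>d\<close> gives
  \<open>a\<^sub>d < b\<^sub>d\<close> for all \<open>d \<ge> n\<close>.  A forbidden word longer than \<open>n + 1\<close> excludes no more strings than
  its prefix of length \<open>n + 1\<close> does.
\<close>

definition avoiding :: "'a list \<Rightarrow> nat \<Rightarrow> 'a list set" where
  "avoiding f d = {u. length u = d \<and> \<not> sublist f u}"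

lemma finite_avoiding [simp]: "finite (avoiding (f :: bool list) d)"
  by (rule finite_subset[OF _ finite_binary_strings[of d]])
    (auto simp: avoiding_def binary_strings_def)

lemma card_avoiding_short:
  assumes "d < length (f :: bool list)"
  shows "card (avoiding f d) = 2 ^ d"
proof -
  have "avoiding f d = {u. set u \<subseteq> UNIV \<and> length u = d}"
    using assms by (auto simp: avoiding_def dest: sublist_length_le)
  then show ?thesis
    using card_lists_length_eq[of "UNIV :: bool set" d] by simp
qed

lemma avoiding_appendD:
  assumes "u @ v \<in> avoiding f d" "length u = k"
  shows "u \<in> avoiding f k"
  using assms unfolding avoiding_def by (auto intro: sublist_appendI dest: sublist_order.order_trans)

lemma last_disagreement:
  fixes x y :: "bool list"
  assumes "length x = length y" "x \<noteq> y"
  obtains i where "i < length y" "x = take i x @ (\<not> y ! i) # drop (Suc i) y"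
proof -
  define D where "D = {i. i < length y \<and> x ! i \<noteq> y ! i}"
  have D: "finite D" "D \<noteq> {}"
    using assms by (auto simp: D_def list_eq_iff_nth_eq)
  define i where "i = Max D"
  have i: "i < length y" "x ! i \<noteq> y ! i"
    using Max_in[OF D] by (auto simp: i_def D_def)
  have "x ! j = y ! j" if "i < j" "j < length y" for j
  proof -
    have "j \<notin> D"
      using Max_ge[OF D(1), of j] that(1) by (auto simp: i_def)
    then show ?thesis using that(2) by (simp add: D_def)
  qed
  then have "drop (Suc i) x = drop (Suc i) y"
    using assms(1) by (auto intro!: nth_equalityI)
  moreover have "x = take i x @ x ! i # drop (Suc i) x"
    using i(1) assms(1) by (simp add: id_take_nth_drop)
  moreover have "x ! i = (\<not> y ! i)"
    using i(2) by blast
  ultimately show thesis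
    using i(1) that by simp
qed

text \<open>
  Cutting a string that avoids \<open>f\<close> just before the last place where its final \<open>\<bar>f\<bar>\<close> letters
  disagree with \<open>f\<close> loses no information once the place is known: over a binary alphabet the
  disagreeing letter is forced, and the letters after it are those of \<open>f\<close>.
\<close>

lemma card_avoiding_le_sum:
  fixes f :: "bool list"
  shows "card (avoiding f (k + length f)) \<le> (\<Sum>i<length f. card (avoiding f (k + i)))"
proof -
  let ?ext = "\<lambda>i w. w @ (\<not> f ! i) # drop (Suc i) f"
  have "avoiding f (k + length f) \<subseteq> (\<Union>i<length f. ?ext i ` avoiding f (k + i))"
  proof
    fix u assume u: "u \<in> avoiding f (k + length f)"
    then have len: "length u = k + length f" and "\<not> sublist f u"
      by (auto simp: avoiding_def)
    then have "drop k u \<noteq> f"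
      by (metis sublist_drop)
    moreover have "length (drop k u) = length f"
      using len by simp
    ultimately obtain i where i: "i < length f" "drop k u = ?ext i (take i (drop k u))"
      using last_disagreement by metis
    have "u = take k u @ drop k u"
      by simp
    also have "\<dots> = ?ext i (take k u @ take i (drop k u))"
      by (subst i(2)) simp
    finally have eq: "u = ?ext i (take k u @ take i (drop k u))" .
    then have "take k u @ take i (drop k u) \<in> avoiding f (k + i)"
      using u i(1) len by (metis avoiding_appendD take_add length_take min.absorb2
          nat_add_left_cancel_le less_imp_le)
    then show "u \<in> (\<Union>i<length f. ?ext i ` avoiding f (k + i))"
      using eq i(1) by blast
  qed
  then have "card (avoiding f (k + length f)) \<le> card (\<Union>i<length f. ?ext i ` avoiding f (k + i))"
    by (intro card_mono) auto
  also have "\<dots> \<le> (\<Sum>i<length f. card (?ext i ` avoiding f (k + i)))"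
    by (rule card_UN_le) simp
  also have "\<dots> \<le> (\<Sum>i<length f. card (avoiding f (k + i)))"
    by (intro sum_mono card_image_le) simp
  finally show ?thesis .
qed

text \<open>
  Among the \<open>2 b\<^sub>d\<close> one-letter extensions of strings avoiding \<open>g\<close>, those that contain \<open>g\<close> have it as
  a suffix, and what precedes this suffix is a shorter string avoiding \<open>g\<close>.
\<close>

lemma double_card_avoiding_le:
  fixes g :: "bool list"
  assumes "length g = Suc n"
  shows "2 * card (avoiding g (k + n)) \<le> card (avoiding g (Suc (k + n))) + card (avoiding g k)"
proof -
  let ?W = "(\<lambda>(w, x). w @ [x]) ` (avoiding g (k + n) \<times> (UNIV :: bool set))"
  have "inj_on (\<lambda>(w, x). w @ [x]) (avoiding g (k + n) \<times> (UNIV :: bool set))"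
    by (auto simp: inj_on_def)
  then have card_W: "card ?W = 2 * card (avoiding g (k + n))"
    by (simp add: card_image card_cartesian_product)
  have "?W \<subseteq> avoiding g (Suc (k + n)) \<union> (\<lambda>w. w @ g) ` avoiding g k"
  proof
    fix u assume "u \<in> ?W"
    then obtain w x where w: "w \<in> avoiding g (k + n)" and u: "u = w @ [x]"
      by auto
    show "u \<in> avoiding g (Suc (k + n)) \<union> (\<lambda>w. w @ g) ` avoiding g k"
    proof (cases "sublist g u")
      case False
      then show ?thesis using w u by (auto simp: avoiding_def)
    next
      case True
      then obtain ps ss where dec: "u = ps @ g @ ss"
        by (auto simp: sublist_def)
      have "ss = []"
      proof (cases ss rule: rev_cases)
        case (snoc ss' y)
        then have "w = ps @ g @ ss'" using dec u by simp
        then show ?thesis using w by (auto simp: avoiding_def)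
      qed
      then have u': "u = ps @ g" using dec by simp
      have "g \<noteq> []" using assms by auto
      then have "w = ps @ butlast g"
        using u u' by (metis butlast_append butlast_snoc)
      moreover have "length ps = k"
        using w u assms arg_cong[OF u', of length] by (simp add: avoiding_def)
      ultimately have "ps \<in> avoiding g k"
        using w by (metis avoiding_appendD)
      then show ?thesis using u' by blast
    qed
  qed
  then have "card ?W \<le> card (avoiding g (Suc (k + n)) \<union> (\<lambda>w. w @ g) ` avoiding g k)"
    by (intro card_mono) auto
  also have "\<dots> \<le> card (avoiding g (Suc (k + n))) + card ((\<lambda>w. w @ g) ` avoiding g k)"
    by (rule card_Un_le)
  also have "\<dots> \<le> card (avoiding g (Suc (k + n))) + card (avoiding g k)"
    by (intro add_left_mono card_image_le) simp
  finally show ?thesis unfolding card_W .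
qed

text \<open>
  By the previous inequality, the excess of \<open>b\<^sub>k\<^sub>+\<^sub>n\<close> over the sum of the \<open>n\<close> preceding terms does not
  decrease with \<open>k\<close>; at \<open>k = 0\<close> it is \<open>2\<^sup>n - (1 + 2 + \<dots> + 2\<^sup>n\<^sup>-\<^sup>1) = 1\<close>.
\<close>

lemma card_avoiding_ge_sum:
  fixes g :: "bool list"
  assumes "length g = Suc n"
  shows "(\<Sum>i<n. card (avoiding g (k + i))) < card (avoiding g (k + n))"
proof (induction k)
  case 0
  have "(\<Sum>i<n. card (avoiding g i)) = (\<Sum>i<n. 2 ^ i)"
    using assms by (intro sum.cong) (auto simp: card_avoiding_short)
  also have "\<dots> < 2 ^ n"
    by (induction n) auto
  finally show ?case
    using assms by (simp add: card_avoiding_short)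
next
  case (Suc k)
  have "(\<Sum>i<n. card (avoiding g (Suc k + i))) + card (avoiding g k)
      = (\<Sum>i<Suc n. card (avoiding g (k + i)))"
    by (subst sum.lessThan_Suc_shift) simp
  also have "\<dots> < 2 * card (avoiding g (k + n))"
    using Suc.IH by simp
  also have "\<dots> \<le> card (avoiding g (Suc k + n)) + card (avoiding g k)"
    using double_card_avoiding_le[OF assms, of k] by simp
  finally show ?case by simp
qed

lemma card_avoiding_le_Suc_length:
  fixes f g :: "bool list"
  assumes "length g = Suc (length f)"
  shows "card (avoiding f d) \<le> card (avoiding g d)"
proof (induction d rule: less_induct)
  case (less d)
  show ?case
  proof (cases "d < length f")
    case True
    then show ?thesis using assms by (simp add: card_avoiding_short)
  next
    case False
    then obtain k where d: "d = k + length f"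
      by (metis add.commute le_Suc_ex not_less)
    have "card (avoiding f d) \<le> (\<Sum>i<length f. card (avoiding f (k + i)))"
      unfolding d by (rule card_avoiding_le_sum)
    also have "\<dots> \<le> (\<Sum>i<length f. card (avoiding g (k + i)))"
      using less.IH d by (intro sum_mono) auto
    also have "\<dots> \<le> card (avoiding g d)"
      unfolding d using card_avoiding_ge_sum[OF assms] by (rule less_imp_le)
    finally show ?thesis .
  qed
qed

lemma card_avoiding_less_longer:
  fixes f g :: "bool list"
  assumes "length f < length g" "length f \<le> d"
  shows "card (avoiding f d) < card (avoiding g d)"
proof -
  define g' where "g' = take (Suc (length f)) g"
  have g': "length g' = Suc (length f)"
    using assms(1) by (simp add: g'_def)
  obtain k where d: "d = k + length f"
    using assms(2) by (metis add.commute le_Suc_ex)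
  have "card (avoiding f d) \<le> (\<Sum>i<length f. card (avoiding f (k + i)))"
    unfolding d by (rule card_avoiding_le_sum)
  also have "\<dots> \<le> (\<Sum>i<length f. card (avoiding g' (k + i)))"
    by (intro sum_mono card_avoiding_le_Suc_length g')
  also have "\<dots> < card (avoiding g' d)"
    unfolding d by (rule card_avoiding_ge_sum[OF g'])
  also have "avoiding g' d \<subseteq> avoiding g d"
    unfolding avoiding_def g'_def using sublist_take sublist_order.order_trans by blast
  then have "card (avoiding g' d) \<le> card (avoiding g d)"
    by (intro card_mono) auto
  finally show ?thesis .
qed

theorem theorem2p1:
  fixes d :: nat and f f' :: bitstring
  assumes "d \<ge> 1"
    and "1 \<le> length f" and "length f \<le> d"
    and "1 \<le> length f'" and "length f' \<le> d"
    and "digraph_iso (fib_cube d f) (fib_cube d f')"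
  shows "length f = length f'"
proof -
  obtain h where "bij_betw h (verts (fib_cube d f)) (verts (fib_cube d f'))"
    using assms(6) unfolding digraph_iso_fib_cube_iff by blast
  then have "card (avoiding f d) = card (avoiding f' d)"
    unfolding verts_fib_cube avoiding_def by (rule bij_betw_same_card)
  then show ?thesis
    using card_avoiding_less_longer[of f f' d] card_avoiding_less_longer[of f' f d] assms(3,5)
    by (cases "length f" "length f'" rule: linorder_cases) auto
qed

end
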